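(* Let $f(x)=a_1x+a_2\frac{x^2}{2!}+a_3\frac{x^3}{3!}+\cdots\in\mathbf{C}[[x]]$ be a formal power series with $a_1\neq 0$, and let $f^{\langle -1\rangle}(x)\in\mathbf{C}[[x]]$ be its inverse under composition. Then $$f^{\langle -1\rangle}(x)=\ln \sum_{m\ge 0} \left.\left(\frac{1}{f'(x)}\frac{d}{dx}\right)^m\left(e^x\right)\right|_{x=0}\frac{x^m}{m!}.$$
   Context: $\mathbf{C}[[x]]$ is the algebra of formal power series with complex coefficients. Formal power series with zero constant term and nonzero linear coefficient form a group under composition $(f\diamond g)(x)=f(g(x))$ with unit $x$; $f^{\langle -1\rangle}$ is the inverse of $f$ in this group, i.e. $f(f^{\langle -1\rangle}(x))=x$. Since $a_1\ne0$, $1/f'(x)\in\mathbf{C}[[x]]$. The operator $\left(\frac{1}{f'(x)}\frac{d}{dx}\right)^m$ is the $m$-fold iterate of the map $h\mapsto \frac{1}{f'(x)}h'(x)$ on $\mathbf{C}[[x]]$ (the identity for $m=0$); $e^x=\sum_{k\ge0}x^k/k!$; $|_{x=0}$ denotes taking the constant term. The series inside the logarithm has constant term $1$, and $\ln(1+h)=\sum_{k\ge1}(-1)^{k-1}h^k/k$ for a formal power series $h$ with zero constant term. *)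

theory Defs
  imports Complex_Main "HOL-Computational_Algebra.Formal_Power_Series"
begin

(* Only meaningful for fps_nth F 0 = 1, since the substituted series must have zero constant term. *)
definition fps_log :: "complex fps \<Rightarrow> complex fps" where
  "fps_log F = fps_ln 1 oo (F - 1)"

lemma fps_log_nth:
  assumes "fps_nth h 0 = 0"
  shows "fps_nth (fps_log (1 + h)) n = (\<Sum>k=1..n. (-1) ^ (k - 1) * fps_nth (h ^ k) n / of_nat k)"
proof -
  have "fps_nth (fps_log (1 + h)) n = (\<Sum>k=0..n. fps_nth (fps_ln 1) k * fps_nth (h ^ k) n)"
    by (simp add: fps_log_def fps_compose_nth)
  also have "\<dots> = (\<Sum>k=1..n. fps_nth (fps_ln 1) k * fps_nth (h ^ k) n)"
    by (simp add: sum.atLeast_Suc_atMost)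
  also have "\<dots> = (\<Sum>k=1..n. (-1) ^ (k - 1) * fps_nth (h ^ k) n / of_nat k)"
    by (rule sum.cong) (auto simp: fps_ln_nth)
  finally show ?thesis .
qed

(* For fps_nth f 1 nonzero, inverse (fps_deriv f) is the multiplicative inverse of f'. *)
definition scaled_deriv :: "complex fps \<Rightarrow> complex fps \<Rightarrow> complex fps" where
  "scaled_deriv f h = inverse (fps_deriv f) * fps_deriv h"

end

theory Submission
  imports Defs
begin

text \<open>
  Let \<open>g\<close> be the compositional inverse of \<open>f\<close>. Substituting \<open>x = g(y)\<close> turns the derivation
  \<open>(1/f') d/dx\<close> into \<open>d/dy\<close>, because \<open>g' = 1 / (f' \<circ> g)\<close>
  (\<open>scaled_deriv_compose_fps_inv\<close>). Iterating this and taking constant terms, which substitution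
  of \<open>g\<close> does not change, shows that \<open>((1/f') d/dx)\<^sup>m h\<close> at \<open>0\<close>, divided by \<open>m!\<close>, is the \<open>m\<close>-th
  coefficient of \<open>h \<circ> g\<close> (\<open>scaled_deriv_funpow_nth_0\<close>). For \<open>h = e\<^sup>x\<close> the series inside the
  logarithm is therefore \<open>exp \<circ> g\<close>, whose logarithm is \<open>g\<close>.
\<close>

lemma scaled_deriv_compose_fps_inv:
  assumes "fps_nth f 0 = 0" and "fps_nth f 1 \<noteq> 0"
  shows "scaled_deriv f h oo fps_inv f = fps_deriv (h oo fps_inv f)"
proof -
  have g0: "fps_nth (fps_inv f) 0 = 0"
    by (simp add: fps_inv_def)
  have "scaled_deriv f h oo fps_inv f
      = inverse (fps_deriv f oo fps_inv f) * (fps_deriv h oo fps_inv f)"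
    using assms(2)
    by (simp add: scaled_deriv_def fps_compose_mult_distrib[OF g0] fps_inverse_compose[OF g0])
  also have "\<dots> = fps_deriv (h oo fps_inv f)"
    using assms by (simp add: fps_compose_deriv[OF g0] fps_inv_deriv)
  finally show ?thesis .
qed

lemma scaled_deriv_funpow_compose_fps_inv:
  assumes "fps_nth f 0 = 0" and "fps_nth f 1 \<noteq> 0"
  shows "(scaled_deriv f ^^ m) h oo fps_inv f = (fps_deriv ^^ m) (h oo fps_inv f)"
  by (induction m) (use assms in \<open>simp_all add: scaled_deriv_compose_fps_inv\<close>)

lemma scaled_deriv_funpow_nth_0:
  assumes "fps_nth f 0 = 0" and "fps_nth f 1 \<noteq> 0"
  shows "fps_nth ((scaled_deriv f ^^ m) h) 0 = fact m * fps_nth (h oo fps_inv f) m"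
proof -
  have "fps_nth ((scaled_deriv f ^^ m) h) 0
      = fps_nth ((scaled_deriv f ^^ m) h oo fps_inv f) 0"
    by simp
  also have "\<dots> = fact m * fps_nth (h oo fps_inv f) m"
    by (simp only: scaled_deriv_funpow_compose_fps_inv[OF assms] fps_0th_higher_deriv)
  finally show ?thesis .
qed

lemma fps_log_fps_exp_compose:
  assumes g0: "fps_nth g 0 = 0"
  shows "fps_log (fps_exp 1 oo g) = g"
proof -
  have "(fps_exp 1 oo g) - 1 = (fps_exp 1 - 1) oo g"
    by (simp add: fps_compose_sub_distrib)
  then have "fps_log (fps_exp 1 oo g) = (fps_ln 1 oo (fps_exp 1 - 1)) oo g"
    by (simp add: fps_log_def fps_compose_assoc[OF g0])
  also have "fps_ln 1 oo (fps_exp 1 - 1) = (fps_X :: complex fps)"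
    by (simp add: fps_ln_fps_exp_inv fps_inv_fps_exp_compose)
  finally show ?thesis
    by (simp add: g0)
qed

theorem theorem1:
  fixes a :: "nat \<Rightarrow> complex" and f :: "complex fps"
  assumes "f = Abs_fps (\<lambda>n. if n = 0 then 0 else a n / fact n)"
    and "a 1 \<noteq> 0"
  shows "fps_inv f =
    fps_log (Abs_fps (\<lambda>m. fps_nth ((scaled_deriv f ^^ m) (fps_exp 1)) 0 / fact m))"
proof -
  have f: "fps_nth f 0 = 0" "fps_nth f 1 \<noteq> 0"
    using assms by simp_all
  have "Abs_fps (\<lambda>m. fps_nth ((scaled_deriv f ^^ m) (fps_exp 1)) 0 / fact m)
      = fps_exp 1 oo fps_inv f"
    by (rule fps_ext) (simp add: scaled_deriv_funpow_nth_0[OF f])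
  moreover have "fps_nth (fps_inv f) 0 = 0"
    by (simp add: fps_inv_def)
  ultimately show ?thesis
    by (simp add: fps_log_fps_exp_compose)
qed

end
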